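(* For every loopless graph $G$, the single-variable interlace polynomial $q_N(G;y)$, defined by the reduction formula given in the context, has the explicit expansion $$q_N(G;y)=\sum_{S\subseteq V(G)}(y-1)^{n(G[S])}.$$
   Context: Graphs are finite, undirected, without multiple edges; in this statement they are loopless, and the null graph (no vertices) is allowed. For $S\subseteq V(G)$, $G[S]$ is the subgraph induced by $S$; $G-a$ means deletion of the vertex $a$. $n(G)$ denotes the nullity over $\mathbb{F}_2$ of the adjacency matrix of $G$ ($0$ for the null graph). Pivot: for distinct vertices $a,b$ of $G$, partition $V(G)\setminus\{a,b\}$ into classes: (C1) vertices adjacent to both $a$ and $b$; (C2) vertices adjacent to $a$ but not $b$; (C3) vertices adjacent to $b$ but not $a$; (C4) vertices adjacent to neither. The graph $G^{ab}$ has vertex set $V(G)$ and is obtained from $G$ by toggling (edge becomes non-edge and vice versa) every pair $uv$ where $u$ and $v$ lie in two different classes among (C1), (C2), (C3). All other adjacencies are unchanged. The single-variable interlace polynomial is the map $G\mapsto q_N(G;y)\in\mathbb{Z}[y]$ on loopless graphs determined by: $q_N(G;y)=q_N(G-a;y)+q_N(G^{ab}-b;y)$ for every edge $ab$ of $G$; and $q_N(E_n;y)=y^n$ for all $n\ge 0$, where $E_n$ is the graph with $n$ vertices and no edges. *)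

theory Defs
  imports
    "Graph_Theory.Graph_Theory"
    "Jordan_Normal_Form.Matrix_Kernel"
    "HOL-Computational_Algebra.Polynomial"
    "HOL-Library.FuncSet"
    "HOL-Library.Z2"
begin

text \<open>
  Finite simple graphs are the instances of \<^locale>\<open>pair_graph\<close>: finite vertex set, symmetric
  arc relation, no loops. The vertex set may be empty. An edge ab is the pair of arcs (a,b), (b,a).
\<close>

definition induced :: "'a pair_pre_digraph \<Rightarrow> 'a set \<Rightarrow> 'a pair_pre_digraph" where
  "induced G S = \<lparr> pverts = S, parcs = {e \<in> parcs G. fst e \<in> S \<and> snd e \<in> S} \<rparr>"

definition delete :: "'a pair_pre_digraph \<Rightarrow> 'a \<Rightarrow> 'a pair_pre_digraph" where
  "delete G a = induced G (pverts G - {a})"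

lemma with_proj_induced: "with_proj (induced G S) = induce_subgraph (with_proj G) S"
  by (simp add: induced_def induce_subgraph_def with_proj_def)

lemma (in pair_wf_digraph) with_proj_delete:
  "with_proj (delete G a) = pre_digraph.del_vert (with_proj G) a"
  by (auto simp: delete_def induced_def with_proj_def pre_digraph.del_vert_def
      dest: arc_fst_in_verts arc_snd_in_verts)

definition pivot :: "'a pair_pre_digraph \<Rightarrow> 'a \<Rightarrow> 'a \<Rightarrow> 'a pair_pre_digraph" where
  "pivot G a b =
    (let C1 = {v \<in> pverts G - {a, b}. (a, v) \<in> parcs G \<and> (b, v) \<in> parcs G};
         C2 = {v \<in> pverts G - {a, b}. (a, v) \<in> parcs G \<and> (b, v) \<notin> parcs G};
         C3 = {v \<in> pverts G - {a, b}. (a, v) \<notin> parcs G \<and> (b, v) \<in> parcs G};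
         T = C1 \<times> C2 \<union> C2 \<times> C1 \<union> C1 \<times> C3 \<union> C3 \<times> C1 \<union> C2 \<times> C3 \<union> C3 \<times> C2
     in \<lparr> pverts = pverts G, parcs = (parcs G - T) \<union> (T - parcs G) \<rparr>)"

definition adj_matrix :: "'a list \<Rightarrow> 'a pair_pre_digraph \<Rightarrow> bit mat" where
  "adj_matrix vs G =
    mat (length vs) (length vs) (\<lambda>(i, j). if (vs ! i, vs ! j) \<in> parcs G then 1 else 0)"

text \<open>
  The choice of enumeration of the vertices is immaterial, since two enumerations give
  matrices that are conjugate by a permutation matrix.
\<close>

definition nullity :: "'a pair_pre_digraph \<Rightarrow> nat" where
  "nullity G = kernel_dim (adj_matrix (SOME vs. distinct vs \<and> set vs = pverts G) G)"

text \<open>The indeterminate y of the polynomial ring over the integers is \<^term>\<open>[:0, 1:] :: int poly\<close>.\<close>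

definition interlace_recursion :: "('a pair_pre_digraph \<Rightarrow> int poly) \<Rightarrow> bool" where
  "interlace_recursion q \<longleftrightarrow>
    (\<forall>G a b. pair_graph G \<and> (a, b) \<in> parcs G \<longrightarrow>
       q G = q (delete G a) + q (delete (pivot G a b) b)) \<and>
    (\<forall>G. pair_graph G \<and> parcs G = {} \<longrightarrow> q G = [:0, 1:] ^ card (pverts G))"

text \<open>
  Extensionality fixes the value of the map outside the finite simple graphs, where the
  recursion says nothing; without it the description would not be unique.
\<close>

definition interlace_poly :: "'a pair_pre_digraph \<Rightarrow> int poly" where
  "interlace_poly = (THE q. q \<in> extensional {G. pair_graph G} \<and> interlace_recursion q)"

end

theory Submission
  imports Defs
begin

text \<open>
  The recursion determines an interlace polynomial uniquely, since both graphs on its right-hand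
  side have one vertex fewer (\<open>interlace_recursion_unique\<close>). It therefore suffices that the
  subset expansion \<open>Q(G) = \<Sum>\<^sub>S (y - 1) ^ n(G[S])\<close> satisfies the recursion. On edgeless graphs
  it does by the binomial theorem, because there \<open>n(G[S]) = card S\<close>.

  Now let \<open>ab\<close> be an edge and let \<open>T\<close> range over the subsets of \<open>V(G) - {a, b}\<close>. The terms of \<open>Q(G)\<close>
  with \<open>a \<notin> S\<close> add up to \<open>Q(G - a)\<close>. The remaining sets \<open>S\<close> are the sets \<open>T \<union> {a, b}\<close> and
  \<open>T \<union> {a}\<close>, and the vertex subsets of \<open>G\<^sup>a\<^sup>b - b\<close> are the sets \<open>T\<close> and \<open>T \<union> {a}\<close>. These match
  term by term:
    \<open>n(G\<^sup>a\<^sup>b[T]) = n(G[T \<union> {a, b}])\<close> and \<open>n(G\<^sup>a\<^sup>b[T \<union> {a}]) = n(G[T \<union> {a}])\<close>.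

  Both equalities rest on one formula: over the two-element field, the adjacency matrices
  \<open>A\<close> of \<open>G\<close> and \<open>A'\<close> of the pivot satisfy, away from \<open>a\<close> and \<open>b\<close>,
    \<open>A' v u = A v u - A v a * A b u - A v b * A a u\<close>  (\<open>adj_pivot\<close>),
  because the toggled pairs are exactly those whose vectors of adjacencies to \<open>a\<close> and \<open>b\<close> are
  linearly independent, and the subtracted quantity is the determinant of these two vectors.
  So \<open>A'\<close> restricted to \<open>T\<close> is the Schur complement of the block with rows and columns
  \<open>a, b\<close>, which is \<open>((0, 1), (1, 0))\<close>, in \<open>A\<close> restricted to \<open>T \<union> {a, b}\<close>; this gives the first equality
  (\<open>card_nullspace_schur_complement\<close>). When \<open>a\<close> is kept and \<open>b\<close> is deleted, the subtracted terms
  are multiples of column \<open>a\<close> and of row \<open>a\<close>, so they amount to elementary operations; this gives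
  the second equality (\<open>card_nullspace_shear\<close>).

  Nullities are compared by counting: a null space over the two-element field has
  \<open>2 ^ nullity\<close> elements, so any bijection between two null spaces, indexed by arbitrary vertex
  sets, suffices. This removes the enumeration of the vertices from the argument.
\<close>

section \<open>Counting the kernel of a matrix over a finite field\<close>

text \<open>Each vector has exactly one tuple of coordinates in a fixed basis.\<close>

lemma (in vectorspace) card_carrier_eq_power_dim:
  assumes finV: "finite (carrier V)"
  shows "card (carrier V) = card (carrier K) ^ dim"
proof -
  have "gen_set (carrier V)"
    using in_own_span[of "carrier V"] span_is_subset2[of "carrier V"] by auto
  then have "fin_dim"
    unfolding fin_dim_def using finV by blast
  then obtain B where B: "finite B" "basis B"
    using finite_basis_exists by blast
  have BV: "B \<subseteq> carrier V"
    using B(2) by (simp add: basis_def)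
  have unique: "\<And>v. v \<in> carrier V \<Longrightarrow> \<exists>!c. c \<in> B \<rightarrow>\<^sub>E carrier K \<and> lincomb c B = v"
    using basis_criterion[OF B(1) BV] B(2) by blast
  have closed: "lincomb c B \<in> carrier V" if "c \<in> B \<rightarrow>\<^sub>E carrier K" for c
    using that BV by (intro lincomb_closed) auto
  have "bij_betw (\<lambda>c. lincomb c B) (B \<rightarrow>\<^sub>E carrier K) (carrier V)"
    unfolding bij_betw_def inj_on_def using unique closed by blast
  then have "card (carrier V) = card (B \<rightarrow>\<^sub>E carrier K)"
    by (simp add: bij_betw_same_card)
  then show ?thesis
    using B by (simp add: card_funcsetE dim_basis)
qed

lemma card_mat_kernel:
  fixes A :: "'f :: field mat"
  assumes fin: "finite (UNIV :: 'f set)"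
  shows "card (mat_kernel A) = card (UNIV :: 'f set) ^ kernel_dim A"
proof -
  interpret kernel "dim_row A" "dim_col A" A
    by unfold_locales auto
  have "mat_kernel A \<subseteq> vec (dim_col A) ` ({..<dim_col A} \<rightarrow>\<^sub>E UNIV)"
  proof
    fix v assume "v \<in> mat_kernel A"
    then have v: "v = vec (dim_col A) (restrict (($) v) {..<dim_col A})"
      by (intro eq_vecI) (auto simp: mat_kernel_def)
    show "v \<in> vec (dim_col A) ` ({..<dim_col A} \<rightarrow>\<^sub>E UNIV)"
      by (subst v, rule imageI, rule restrict_PiE_iff[THEN iffD2]) simp
  qed
  then have "finite (mat_kernel A)"
    by (rule finite_subset) (simp add: finite_PiE fin)
  then show ?thesis
    using Ker.card_carrier_eq_power_dim by simp
qed

section \<open>Null spaces of arrays indexed by a set\<close>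

text \<open>
  Vectors are functions on the whole type. Requiring them to vanish outside the index set makes
  each vector indexed by \<open>S\<close> appear once, so that cardinalities are the right ones.
\<close>

definition nullspace :: "('a \<Rightarrow> 'a \<Rightarrow> 'f :: comm_ring_1) \<Rightarrow> 'a set \<Rightarrow> ('a \<Rightarrow> 'f) set" where
  "nullspace N S = {x. (\<forall>v. v \<notin> S \<longrightarrow> x v = 0) \<and> (\<forall>v\<in>S. (\<Sum>u\<in>S. N v u * x u) = 0)}"

lemma card_nullspace_eq_mat_kernel:
  fixes N :: "'a \<Rightarrow> 'a \<Rightarrow> 'f :: comm_ring_1"
  assumes vs: "distinct vs" "set vs = S"
  shows "card (nullspace N S) =
    card (mat_kernel (mat (length vs) (length vs) (\<lambda>(i, j). N (vs ! i) (vs ! j))))"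
proof -
  define n where "n = length vs"
  define A where "A = mat n n (\<lambda>(i, j). N (vs ! i) (vs ! j))"
  have bij: "bij_betw ((!) vs) {..<n} S"
    using vs by (simp add: bij_betw_nth n_def)
  have row: "(A *\<^sub>v w) $ i = (\<Sum>u\<in>S. N (vs ! i) u * x u)"
    if "i < n" "dim_vec w = n" "\<And>j. j < n \<Longrightarrow> w $ j = x (vs ! j)" for w i and x :: "'a \<Rightarrow> 'f"
  proof -
    have "(A *\<^sub>v w) $ i = (\<Sum>j<n. N (vs ! i) (vs ! j) * x (vs ! j))"
      using that by (simp add: A_def scalar_prod_def atLeast0LessThan)
    also have "\<dots> = (\<Sum>u\<in>S. N (vs ! i) u * x u)"
      by (rule sum.reindex_bij_betw[OF bij])
    finally show ?thesis .
  qed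
  have nth_S: "vs ! i \<in> S" if "i < n" for i
    using that vs by (auto simp: n_def)
  have S_nth: "\<exists>i<n. v = vs ! i" if "v \<in> S" for v
    using that vs by (auto simp: n_def in_set_conv_nth)
  have "bij_betw (\<lambda>x. vec n (\<lambda>i. x (vs ! i))) (nullspace N S) (mat_kernel A)"
  proof (rule bij_betw_imageI)
    show "inj_on (\<lambda>x. vec n (\<lambda>i. x (vs ! i))) (nullspace N S)"
    proof (rule inj_onI, rule ext)
      fix x y v
      assume xy: "x \<in> nullspace N S" "y \<in> nullspace N S"
        and eq: "vec n (\<lambda>i. x (vs ! i)) = vec n (\<lambda>i. y (vs ! i))"
      show "x v = y v"
      proof (cases "v \<in> S")
        case True
        then obtain i where "i < n" "v = vs ! i" using S_nth by blast
        then show ?thesis using arg_cong[OF eq, of "\<lambda>w. w $ i"] by simp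
      qed (use xy in \<open>simp add: nullspace_def\<close>)
    qed
    show "(\<lambda>x. vec n (\<lambda>i. x (vs ! i))) ` nullspace N S = mat_kernel A"
    proof (intro equalityI subsetI)
      fix w assume "w \<in> (\<lambda>x. vec n (\<lambda>i. x (vs ! i))) ` nullspace N S"
      then obtain x where x: "x \<in> nullspace N S" and w: "w = vec n (\<lambda>i. x (vs ! i))"
        by blast
      have "A *\<^sub>v w = 0\<^sub>v n"
      proof (rule eq_vecI)
        fix i assume "i < dim_vec (0\<^sub>v n :: 'f vec)"
        then have "i < n" by simp
        then show "(A *\<^sub>v w) $ i = 0\<^sub>v n $ i"
          using row[of i w x] x nth_S[of i] by (simp add: w nullspace_def)
      qed (simp add: A_def)
      then show "w \<in> mat_kernel A"
        by (simp add: mat_kernel_def A_def w)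
    next
      fix w assume w: "w \<in> mat_kernel A"
      define x where "x v = (if v \<in> S then w $ inv_into {..<n} ((!) vs) v else 0)" for v
      have dim_w: "dim_vec w = n" and Aw: "A *\<^sub>v w = 0\<^sub>v n"
        using w by (auto simp: mat_kernel_def A_def)
      have x_nth: "w $ j = x (vs ! j)" if "j < n" for j
        using that nth_S bij by (simp add: x_def bij_betw_def)
      have "(\<Sum>u\<in>S. N v u * x u) = 0" if "v \<in> S" for v
      proof -
        obtain i where "i < n" "v = vs ! i" using S_nth \<open>v \<in> S\<close> by blast
        then show ?thesis using row[of i w x] dim_w x_nth Aw by simp
      qed
      then have "x \<in> nullspace N S"
        by (simp add: nullspace_def x_def)
      moreover have "w = vec n (\<lambda>i. x (vs ! i))"
        using dim_w x_nth by (intro eq_vecI) auto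
      ultimately show "w \<in> (\<lambda>x. vec n (\<lambda>i. x (vs ! i))) ` nullspace N S"
        by blast
    qed
  qed
  then show ?thesis
    by (simp add: bij_betw_same_card A_def n_def)
qed

text \<open>
  The rows \<open>a\<close> and \<open>b\<close> of the larger system read \<open>x b = - (row a on T)\<close> and
  \<open>x a = - (row b on T)\<close>. Hence a solution is determined by its restriction to \<open>T\<close>, and
  substituting these two values into the remaining rows turns \<open>N\<close> into \<open>M\<close>.
\<close>

lemma card_nullspace_schur_complement:
  assumes T: "finite T" "a \<notin> T" "b \<notin> T"
    and ab: "N a a = 0" "N b b = 0" "N a b = 1" "N b a = 1" "a \<noteq> b"
    and M: "\<And>u v. u \<in> T \<Longrightarrow> v \<in> T \<Longrightarrow> M v u = N v u - N v a * N b u - N v b * N a u"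
  shows "card (nullspace M T) = card (nullspace N (insert a (insert b T)))"
proof -
  let ?row = "\<lambda>v x. \<Sum>u\<in>T. N v u * x u"
  let ?lift = "\<lambda>x. x(a := - ?row b x, b := - ?row a x)"
  have row_M: "(\<Sum>u\<in>T. M v u * x u) = ?row v x - N v a * ?row b x - N v b * ?row a x"
    if "v \<in> T" for v x
    using that by (simp add: M algebra_simps sum_subtractf sum_distrib_left sum.distrib)
  have row_N: "(\<Sum>u\<in>insert a (insert b T). N v u * x u) = N v a * x a + N v b * x b + ?row v x"
    for v x
    using T ab by (simp add: add.assoc)
  have row_cong: "?row v x = ?row v y" if "\<And>u. u \<in> T \<Longrightarrow> x u = y u" for v x y
    using that by (intro sum.cong) auto
  have row_upd: "?row v (x(a := s, b := t)) = ?row v x" for v x s t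
    using T by (intro row_cong) auto
  have "bij_betw ?lift (nullspace M T) (nullspace N (insert a (insert b T)))"
  proof (rule bij_betw_byWitness[where f' = "\<lambda>x. x(a := 0, b := 0)"])
    show "\<forall>x\<in>nullspace M T. (?lift x)(a := 0, b := 0) = x"
      using T by (auto simp: nullspace_def)
    show "\<forall>x\<in>nullspace N (insert a (insert b T)). ?lift (x(a := 0, b := 0)) = x"
    proof
      fix x assume x: "x \<in> nullspace N (insert a (insert b T))"
      then have "x b + ?row a x = 0" "x a + ?row b x = 0"
        using ab by (auto simp: nullspace_def row_N simp del: sum.insert)
      then have "x b = - ?row a x" "x a = - ?row b x"
        by (simp_all add: eq_neg_iff_add_eq_0)
      then show "?lift (x(a := 0, b := 0)) = x"
        unfolding row_upd by (auto simp: fun_eq_iff)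
    qed
    show "?lift ` nullspace M T \<subseteq> nullspace N (insert a (insert b T))"
    proof (intro image_subsetI)
      fix x assume "x \<in> nullspace M T"
      then have supp: "\<And>v. v \<notin> T \<Longrightarrow> x v = 0"
        and ker: "\<And>v. v \<in> T \<Longrightarrow> ?row v x - N v a * ?row b x - N v b * ?row a x = 0"
        by (auto simp: nullspace_def row_M)
      have "(\<Sum>u\<in>insert a (insert b T). N v u * (?lift x) u) = 0"
        if "v \<in> insert a (insert b T)" for v
        unfolding row_N row_upd using that ker ab by (auto simp: algebra_simps)
      then show "?lift x \<in> nullspace N (insert a (insert b T))"
        using supp by (simp add: nullspace_def del: sum.insert)
    qed
    show "(\<lambda>x. x(a := 0, b := 0)) ` nullspace N (insert a (insert b T)) \<subseteq> nullspace M T"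
    proof (intro image_subsetI)
      fix x assume x: "x \<in> nullspace N (insert a (insert b T))"
      then have "x b + ?row a x = 0" "x a + ?row b x = 0"
        using ab by (auto simp: nullspace_def row_N simp del: sum.insert)
      then have xab: "x b = - ?row a x" "x a = - ?row b x"
        by (simp_all add: eq_neg_iff_add_eq_0)
      have "(\<Sum>u\<in>T. M v u * (x(a := 0, b := 0)) u) = 0" if "v \<in> T" for v
      proof -
        have "N v a * x a + N v b * x b + ?row v x = 0"
          using x that by (auto simp: nullspace_def row_N simp del: sum.insert)
        then show ?thesis
          unfolding row_M[OF that] row_upd using xab by (simp add: algebra_simps)
      qed
      then show "x(a := 0, b := 0) \<in> nullspace M T"
        using x by (simp add: nullspace_def)
    qed
  qed
  then show ?thesis
    by (rule bij_betw_same_card)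
qed

text \<open>
  Row \<open>a\<close> is the same equation for \<open>M\<close> and \<open>N\<close>; modulo this equation the terms \<open>c v * N a u\<close>
  disappear from the other rows. The terms \<open>N v a * r u\<close> are then absorbed by replacing the
  coordinate \<open>x a\<close> with \<open>x a - (\<Sum>u\<in>T. r u * x u)\<close>, which is invertible and leaves row \<open>a\<close>
  unaffected because \<open>N a a = 0\<close>.
\<close>

lemma card_nullspace_shear:
  fixes M N :: "'a \<Rightarrow> 'a \<Rightarrow> 'b :: comm_ring_1"
  assumes T: "finite T" "a \<notin> T" "N a a = 0"
    and M: "\<And>u v. u \<in> T \<Longrightarrow> v \<in> T \<Longrightarrow> M v u = N v u - N v a * r u - c v * N a u"
    and Ma: "M a a = 0" "\<And>u. u \<in> T \<Longrightarrow> M a u = N a u" "\<And>v. v \<in> T \<Longrightarrow> M v a = N v a"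
  shows "card (nullspace M (insert a T)) = card (nullspace N (insert a T))"
proof -
  let ?row = "\<lambda>v x. \<Sum>u\<in>T. N v u * x u"
  let ?s = "\<lambda>x. \<Sum>u\<in>T. r u * x u"
  have sum_cong: "(\<Sum>u\<in>T. f u * (x(a := t)) u) = (\<Sum>u\<in>T. f u * x u)"
    for f x :: "'a \<Rightarrow> 'b" and t
    using T by (intro sum.cong) auto
  have row_M: "(\<Sum>u\<in>insert a T. M v u * x u) = N v a * (x a - ?s x) + ?row v x - c v * ?row a x"
    if "v \<in> T" for v x
    using that T by (simp add: M Ma algebra_simps sum_subtractf sum_distrib_left sum.distrib)
  have row_Ma: "(\<Sum>u\<in>insert a T. M a u * x u) = ?row a x" for x
    using T by (simp add: Ma)
  have row_N: "(\<Sum>u\<in>insert a T. N v u * x u) = N v a * x a + ?row v x" for v x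
    using T by simp
  have "bij_betw (\<lambda>x. x(a := x a - ?s x)) (nullspace M (insert a T)) (nullspace N (insert a T))"
  proof (rule bij_betw_byWitness[where f' = "\<lambda>x. x(a := x a + ?s x)"])
    show "\<forall>x\<in>nullspace M (insert a T).
        (\<lambda>x. x(a := x a + ?s x)) (x(a := x a - ?s x)) = x"
      by (simp only: sum_cong) simp
    show "\<forall>x\<in>nullspace N (insert a T).
        (\<lambda>x. x(a := x a - ?s x)) (x(a := x a + ?s x)) = x"
      by (simp only: sum_cong) simp
    show "(\<lambda>x. x(a := x a - ?s x)) ` nullspace M (insert a T) \<subseteq> nullspace N (insert a T)"
    proof (intro image_subsetI)
      fix x assume x: "x \<in> nullspace M (insert a T)"
      then have ra: "?row a x = 0"
        by (auto simp: nullspace_def row_Ma simp del: sum.insert)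
      have "(\<Sum>u\<in>insert a T. N v u * (x(a := x a - ?s x)) u) = 0" if "v \<in> insert a T" for v
        unfolding row_N sum_cong
        using that x ra row_M[of v x] T by (auto simp: nullspace_def simp del: sum.insert)
      then show "x(a := x a - ?s x) \<in> nullspace N (insert a T)"
        using x by (simp add: nullspace_def del: sum.insert)
    qed
    show "(\<lambda>x. x(a := x a + ?s x)) ` nullspace N (insert a T) \<subseteq> nullspace M (insert a T)"
    proof (intro image_subsetI)
      fix x assume x: "x \<in> nullspace N (insert a T)"
      then have ra: "?row a x = 0"
        using T by (auto simp: nullspace_def row_N simp del: sum.insert)
      have "(\<Sum>u\<in>insert a T. M v u * (x(a := x a + ?s x)) u) = 0" if "v \<in> insert a T" for v
      proof (cases "v = a")
        case True
        then show ?thesis unfolding True row_Ma sum_cong using ra by simp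
      next
        case False
        then have v: "v \<in> T" using that by simp
        show ?thesis unfolding row_M[OF v] sum_cong
          using v x ra by (auto simp: nullspace_def row_N simp del: sum.insert)
      qed
      then show "x(a := x a + ?s x) \<in> nullspace M (insert a T)"
        using x by (simp add: nullspace_def del: sum.insert)
    qed
  qed
  then show ?thesis
    by (rule bij_betw_same_card)
qed

section \<open>Nullity and pivoting\<close>

definition adj :: "'a pair_pre_digraph \<Rightarrow> 'a \<Rightarrow> 'a \<Rightarrow> bit" where
  "adj G u v = of_bool ((u, v) \<in> parcs G)"

lemma UNIV_bit: "(UNIV :: bit set) = {0, 1}"
  by auto

text \<open>
  The right-hand side involves a chosen enumeration of \<open>S\<close>, the left-hand side does not: nullities
  of graphs on different vertex sets can be compared by bijections between null spaces.
\<close>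

lemma card_nullspace_adj:
  assumes "finite S"
  shows "card (nullspace (adj G) S) = 2 ^ nullity (induced G S)"
proof -
  define vs where "vs = (SOME vs. distinct vs \<and> set vs = S)"
  have vs: "distinct vs" "set vs = S"
    using someI_ex[of "\<lambda>vs. distinct vs \<and> set vs = S"] finite_distinct_list[OF assms]
    unfolding vs_def by blast+
  have "mat (length vs) (length vs) (\<lambda>(i, j). adj G (vs ! i) (vs ! j)) = adj_matrix vs (induced G S)"
    using vs by (intro eq_matI) (auto simp: adj_matrix_def adj_def induced_def)
  moreover have "kernel_dim (adj_matrix vs (induced G S)) = nullity (induced G S)"
    by (simp add: nullity_def vs_def induced_def)
  moreover have "finite (UNIV :: bit set)" "card (UNIV :: bit set) = 2"
    by (simp_all add: UNIV_bit)
  ultimately show ?thesis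
    using card_nullspace_eq_mat_kernel[OF vs, of "adj G"]
      card_mat_kernel[of "adj_matrix vs (induced G S)"]
    by simp
qed

lemma pair_graph_iff:
  "pair_graph G \<longleftrightarrow> finite (pverts G) \<and> sym (parcs G) \<and> irrefl (parcs G) \<and>
    parcs G \<subseteq> pverts G \<times> pverts G"
proof
  assume "pair_graph G"
  then interpret pair_graph G .
  have "irrefl (parcs G)"
    by (rule irreflI) (use pair_no_loops in force)
  moreover have "sym (parcs G)"
    by (rule symI) (rule arcs_symmetric)
  ultimately show "finite (pverts G) \<and> sym (parcs G) \<and> irrefl (parcs G) \<and> parcs G \<subseteq> pverts G \<times> pverts G"
    using pair_finite_verts by (auto dest: in_arcsD1 in_arcsD2)
next
  assume G: "finite (pverts G) \<and> sym (parcs G) \<and> irrefl (parcs G) \<and>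
    parcs G \<subseteq> pverts G \<times> pverts G"
  then have "finite (parcs G)"
    using finite_subset by blast
  moreover have "symmetric (with_proj G)"
    using G by (auto simp: symmetric_def arcs_ends_def arc_to_ends_def)
  ultimately show "pair_graph G"
    using G by unfold_locales (auto simp: irrefl_def)
qed

lemma pair_graph_finite: "pair_graph G \<Longrightarrow> finite (pverts G)"
  by (simp add: pair_graph_iff)

lemma adj_sym: "pair_graph G \<Longrightarrow> adj G u v = adj G v u"
  by (auto simp: pair_graph_iff adj_def dest: symD)

lemma pverts_pivot [simp]: "pverts (pivot G a b) = pverts G"
  by (simp add: pivot_def Let_def)

lemma pverts_delete [simp]: "pverts (delete G a) = pverts G - {a}"
  by (simp add: delete_def induced_def)

lemma pair_graph_delete: "pair_graph G \<Longrightarrow> pair_graph (delete G a)"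
  unfolding pair_graph_iff delete_def induced_def sym_def irrefl_def by auto

text \<open>
  The three classes of the pivot are the nonzero values of the pair
  (adjacency to \<open>a\<close>, adjacency to \<open>b\<close>), so a pair of vertices is toggled iff both have a nonzero
  value and the values differ.
\<close>

lemma arc_pivot_iff:
  "(u, v) \<in> parcs (pivot G a b) \<longleftrightarrow>
    ((u, v) \<in> parcs G) \<noteq>
    (u \<in> pverts G - {a, b} \<and> v \<in> pverts G - {a, b} \<and>
      ((a, u) \<in> parcs G \<or> (b, u) \<in> parcs G) \<and> ((a, v) \<in> parcs G \<or> (b, v) \<in> parcs G) \<and>
      (((a, u) \<in> parcs G) \<noteq> ((a, v) \<in> parcs G) \<or> ((b, u) \<in> parcs G) \<noteq> ((b, v) \<in> parcs G)))"
  unfolding pivot_def Let_def pair_pre_digraph.simps Un_iff Diff_iff mem_Sigma_iff mem_Collect_eq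
  by argo

lemma pair_graph_pivot:
  assumes "pair_graph G"
  shows "pair_graph (pivot G a b)"
proof -
  have sym: "(u, v) \<in> parcs G \<longleftrightarrow> (v, u) \<in> parcs G" for u v
    using assms by (auto simp: pair_graph_iff dest: symD)
  have "sym (parcs (pivot G a b))"
    by (rule symI) (unfold arc_pivot_iff, use sym in blast)
  moreover have "irrefl (parcs (pivot G a b))"
    using assms by (simp add: pair_graph_iff irrefl_def arc_pivot_iff)
  moreover have "parcs (pivot G a b) \<subseteq> pverts G \<times> pverts G"
    using assms by (auto simp: pair_graph_iff arc_pivot_iff)
  ultimately show ?thesis
    using assms by (simp add: pair_graph_iff)
qed

lemma induced_delete: "a \<notin> S \<Longrightarrow> S \<subseteq> pverts G \<Longrightarrow> induced (delete G a) S = induced G S"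
  by (auto simp: delete_def induced_def)

text \<open>
  Two vectors of a plane over the two-element field are linearly independent iff they are nonzero
  and distinct. The toggling condition is thus the determinant of the two adjacency vectors.
\<close>

lemma adj_pivot:
  assumes "pair_graph G" "u \<in> pverts G - {a, b}" "v \<in> pverts G - {a, b}"
  shows "adj (pivot G a b) v u = adj G v u - adj G v a * adj G b u - adj G v b * adj G a u"
proof -
  have "(v, u) \<in> parcs (pivot G a b) \<longleftrightarrow>
    ((v, u) \<in> parcs G) \<noteq>
    (((a, v) \<in> parcs G \<or> (b, v) \<in> parcs G) \<and> ((a, u) \<in> parcs G \<or> (b, u) \<in> parcs G) \<and>
      (((a, v) \<in> parcs G) \<noteq> ((a, u) \<in> parcs G) \<or> ((b, v) \<in> parcs G) \<noteq> ((b, u) \<in> parcs G)))"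
    unfolding arc_pivot_iff using assms(2,3) by simp
  then have "adj (pivot G a b) v u = adj G v u - adj G a v * adj G b u - adj G b v * adj G a u"
    unfolding adj_def
    by (cases "(a, u) \<in> parcs G"; cases "(b, u) \<in> parcs G";
        cases "(a, v) \<in> parcs G"; cases "(b, v) \<in> parcs G"; cases "(v, u) \<in> parcs G") simp_all
  then show ?thesis
    using adj_sym[OF assms(1)] by metis
qed

lemma adj_pivot_fixed:
  "adj (pivot G a b) a v = adj G a v" "adj (pivot G a b) v a = adj G v a"
  by (simp_all add: adj_def arc_pivot_iff)

lemma adj_edge:
  assumes "pair_graph G" "(a, b) \<in> parcs G"
  shows "adj G a a = 0" "adj G b b = 0" "adj G a b = 1" "adj G b a = 1" "a \<noteq> b"
    "a \<in> pverts G" "b \<in> pverts G"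
  using assms by (auto simp: pair_graph_iff adj_def irrefl_def dest: symD)

lemma nullity_induced_pivot_without_ends:
  assumes G: "pair_graph G" "(a, b) \<in> parcs G" and T: "T \<subseteq> pverts G - {a, b}"
  shows "nullity (induced (pivot G a b) T) = nullity (induced G (insert a (insert b T)))"
proof -
  have "finite T"
    using T pair_graph_finite[OF G(1)] finite_subset by blast
  moreover have "card (nullspace (adj (pivot G a b)) T) =
      card (nullspace (adj G) (insert a (insert b T)))"
    using T \<open>finite T\<close> adj_edge[OF G]
    by (intro card_nullspace_schur_complement adj_pivot[OF G(1)]) auto
  ultimately show ?thesis
    by (simp add: card_nullspace_adj)
qed

lemma nullity_induced_pivot_with_one_end:
  assumes G: "pair_graph G" "(a, b) \<in> parcs G" and T: "T \<subseteq> pverts G - {a, b}"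
  shows "nullity (induced (pivot G a b) (insert a T)) = nullity (induced G (insert a T))"
proof -
  have "finite T"
    using T pair_graph_finite[OF G(1)] finite_subset by blast
  moreover have "card (nullspace (adj (pivot G a b)) (insert a T)) =
      card (nullspace (adj G) (insert a T))"
    using T \<open>finite T\<close> adj_edge[OF G]
    by (intro card_nullspace_shear[where r = "adj G b" and c = "\<lambda>v. adj G v b"] adj_pivot[OF G(1)])
      (auto simp: adj_pivot_fixed)
  ultimately show ?thesis
    by (simp add: card_nullspace_adj)
qed

section \<open>The subset expansion and the recursion\<close>

definition nullity_expansion :: "'a pair_pre_digraph \<Rightarrow> int poly" where
  "nullity_expansion G = (\<Sum>S \<in> Pow (pverts G). ([:0, 1:] - 1) ^ nullity (induced G S))"

lemma sum_Pow_split: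
  assumes "finite V" "a \<in> V"
  shows "(\<Sum>S\<in>Pow V. g S) = (\<Sum>S\<in>Pow (V - {a}). g S) + (\<Sum>S\<in>Pow (V - {a}). g (insert a S))"
proof -
  have "Pow V = Pow (V - {a}) \<union> insert a ` Pow (V - {a})"
    using Pow_insert[of a "V - {a}"] assms by (simp add: insert_absorb)
  moreover have "inj_on (insert a) (Pow (V - {a}))"
    by (rule inj_onI) blast
  ultimately show ?thesis
    using assms by (subst \<open>Pow V = _\<close>, subst sum.union_disjoint)
      (auto simp: sum.reindex)
qed

text \<open>
  After the sets that avoid \<open>a\<close> are split off, the rest is indexed by the subsets \<open>T\<close> of
  \<open>V(G) - {a, b}\<close>: the term of \<open>T \<union> {a, b}\<close> in \<open>G\<close> is that of \<open>T\<close> in the pivot, while the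
  term of \<open>T \<union> {a}\<close> is the same in both graphs.
\<close>

lemma nullity_expansion_edge:
  assumes G: "pair_graph G" and ab: "(a, b) \<in> parcs G"
  shows "nullity_expansion G =
    nullity_expansion (delete G a) + nullity_expansion (delete (pivot G a b) b)"
proof -
  let ?W = "pverts G - {a, b}"
  let ?f = "\<lambda>H S. ([:0, 1:] - 1 :: int poly) ^ nullity (induced H S)"
  have ends: "a \<in> pverts G" "b \<in> pverts G" "a \<noteq> b"
    using adj_edge[OF G ab] by auto
  have fin: "finite (pverts G)"
    using G by (rule pair_graph_finite)
  have W: "pverts G - {a} - {b} = ?W" "pverts G - {b} - {a} = ?W"
    by auto
  have "nullity_expansion (delete (pivot G a b) b) = (\<Sum>S\<in>Pow (pverts G - {b}). ?f (pivot G a b) S)"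
    unfolding nullity_expansion_def pverts_delete pverts_pivot
    by (intro sum.cong refl, subst induced_delete) auto
  also have "\<dots> = (\<Sum>T\<in>Pow ?W. ?f (pivot G a b) T) + (\<Sum>T\<in>Pow ?W. ?f (pivot G a b) (insert a T))"
    using sum_Pow_split[of "pverts G - {b}" a "?f (pivot G a b)"] ends fin by (simp add: W)
  also have "\<dots> = (\<Sum>T\<in>Pow ?W. ?f G (insert a (insert b T))) + (\<Sum>T\<in>Pow ?W. ?f G (insert a T))"
    using nullity_induced_pivot_without_ends[OF G ab] nullity_induced_pivot_with_one_end[OF G ab]
    by simp
  also have "\<dots> = (\<Sum>S\<in>Pow (pverts G - {a}). ?f G (insert a S))"
    using sum_Pow_split[of "pverts G - {a}" b "\<lambda>S. ?f G (insert a S)"] ends fin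
    by (simp add: W add.commute)
  finally have "nullity_expansion (delete (pivot G a b) b) =
      (\<Sum>S\<in>Pow (pverts G - {a}). ?f G (insert a S))" .
  moreover have "nullity_expansion (delete G a) = (\<Sum>S\<in>Pow (pverts G - {a}). ?f G S)"
    unfolding nullity_expansion_def pverts_delete
    by (intro sum.cong refl, subst induced_delete) auto
  ultimately show ?thesis
    using sum_Pow_split[OF fin ends(1), of "?f G"] by (simp add: nullity_expansion_def)
qed

text \<open>
  All equations of the null space are trivial, so its elements are the indicator functions of the
  subsets of \<open>S\<close>.
\<close>

lemma nullity_edgeless:
  assumes "finite S" "parcs G = {}"
  shows "nullity (induced G S) = card S"
proof -
  have "nullspace (adj G) S = {x. (\<forall>v. v \<notin> S \<longrightarrow> x v = 0)}"
    using assms(2) by (simp add: nullspace_def adj_def)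
  also have "\<dots> = (\<lambda>T v. of_bool (v \<in> T)) ` Pow S"
  proof (intro equalityI subsetI)
    fix x :: "'a \<Rightarrow> bit" assume "x \<in> {x. \<forall>v. v \<notin> S \<longrightarrow> x v = 0}"
    then show "x \<in> (\<lambda>T v. of_bool (v \<in> T)) ` Pow S"
      by (intro image_eqI[of _ _ "{v. x v = 1}"]) (auto simp: fun_eq_iff)
  qed auto
  finally have "nullspace (adj G) S = (\<lambda>T v. of_bool (v \<in> T)) ` Pow S" .
  moreover have "inj (\<lambda>T (v :: 'a). of_bool (v \<in> T) :: bit)"
    by (rule injI) (auto simp: fun_eq_iff of_bool_eq_iff)
  ultimately have "card (nullspace (adj G) S) = 2 ^ card S"
    using assms(1) by (simp add: card_image inj_on_subset card_Pow)
  then show ?thesis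
    using card_nullspace_adj[OF assms(1), of G] by simp
qed

lemma nullity_expansion_edgeless:
  assumes "pair_graph G" "parcs G = {}"
  shows "nullity_expansion G = [:0, 1:] ^ card (pverts G)"
proof -
  have fin: "finite (pverts G)"
    using assms(1) by (rule pair_graph_finite)
  have "nullity_expansion G = (\<Sum>S\<in>Pow (pverts G). ([:0, 1:] - 1) ^ card S)"
    unfolding nullity_expansion_def
    using nullity_edgeless[OF _ assms(2)] finite_subset[OF _ fin] by (intro sum.cong) auto
  \<comment> \<open>Expanding the product over the vertices is the binomial theorem in its subset form.\<close>
  also have "\<dots> = (\<Prod>v\<in>pverts G. ([:0, 1:] - 1) + 1)"
    using prod_add[OF fin, of "\<lambda>_. [:0, 1:] - 1 :: int poly" "\<lambda>_. 1"] by simp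
  also have "\<dots> = [:0, 1:] ^ card (pverts G)"
    by simp
  finally show ?thesis .
qed

lemma interlace_recursion_nullity_expansion:
  "interlace_recursion (restrict nullity_expansion {G. pair_graph G})"
  unfolding interlace_recursion_def
  by (auto simp: pair_graph_delete pair_graph_pivot nullity_expansion_edgeless
      simp del: pverts_delete intro: nullity_expansion_edge)

text \<open>
  Both graphs on the right-hand side of the recursion have fewer vertices than \<open>G\<close>, so induction
  on the number of vertices applies whichever edge is chosen.
\<close>

lemma interlace_recursion_unique:
  assumes q: "interlace_recursion q" and r: "interlace_recursion r" and "pair_graph G"
  shows "q G = r G"
  using assms(3)
proof (induction "card (pverts G)" arbitrary: G rule: less_induct)
  case less
  show ?case
  proof (cases "parcs G = {}")
    case True
    then show ?thesis
      using q r less.prems by (simp add: interlace_recursion_def)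
  next
    case False
    then obtain a b where ab: "(a, b) \<in> parcs G"
      by auto
    have fin: "finite (pverts G)"
      using less.prems by (rule pair_graph_finite)
    have "card (pverts (delete G a)) < card (pverts G)"
      "card (pverts (delete (pivot G a b) b)) < card (pverts G)"
      using adj_edge(6,7)[OF less.prems ab] fin
      by (simp_all only: pverts_delete pverts_pivot card_Diff1_less)
    then have "q (delete G a) = r (delete G a)"
      "q (delete (pivot G a b) b) = r (delete (pivot G a b) b)"
      using less by (simp_all add: pair_graph_delete pair_graph_pivot)
    moreover have "q G = q (delete G a) + q (delete (pivot G a b) b)"
      "r G = r (delete G a) + r (delete (pivot G a b) b)"
      using q r less.prems ab by (simp_all add: interlace_recursion_def)
    ultimately show ?thesis
      by simp
  qed
qed

theorem corollary10:
  fixes G :: "'a pair_pre_digraph"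
  assumes "pair_graph G"
  shows "interlace_poly G = (\<Sum>S \<in> Pow (pverts G). ([:0, 1:] - 1) ^ nullity (induced G S))"
proof -
  have "interlace_poly = restrict nullity_expansion {G :: 'a pair_pre_digraph. pair_graph G}"
    unfolding interlace_poly_def
  proof (rule the_equality)
    fix q :: "'a pair_pre_digraph \<Rightarrow> int poly"
    assume "q \<in> extensional {G. pair_graph G} \<and> interlace_recursion q"
    then show "q = restrict nullity_expansion {G. pair_graph G}"
      using interlace_recursion_unique[OF _ interlace_recursion_nullity_expansion, of q]
      by (intro extensionalityI[where A = "{G. pair_graph G}"]) auto
  qed (simp add: interlace_recursion_nullity_expansion)
  from fun_cong[OF this, of G] have "interlace_poly G = nullity_expansion G"
    using assms by simp
  then show ?thesis
    by (simp only: nullity_expansion_def)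
qed

end
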